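(* Let $(X,d)$ be an infinite metric space and let $\mathfrak{B}$ be a bornology on $X$ with a closed base such that $X\notin\mathfrak{B}$. The following statements are equivalent. (1) TWO has a winning strategy in $\mathcal{O}_{\mathfrak{B}^s}(X)$. (2) ONE has a winning strategy in $\mathsf{G}_1(\mathcal{O}_{\mathfrak{B}^s},\mathcal{O}_{\mathfrak{B}^s})$ on $X$.
   Context: A bornology on a set $X$ is a family $\mathfrak{B}$ of subsets of $X$ that covers $X$, is closed under finite unions and is closed under taking subsets. A base of $\mathfrak{B}$ is a subfamily $\mathfrak{B}_0\subseteq\mathfrak{B}$ such that every $B\in\mathfrak{B}$ is contained in some $B_0\in\mathfrak{B}_0$; it is a closed base if all its members are closed in $X$. For $B\subseteq X$ and $\delta>0$, $B^\delta=\bigcup_{x\in B}\{y\in X: d(x,y)<\delta\}$. An open $\mathfrak{B}^s$-cover of $X$ is a family $\mathcal{U}$ of open subsets of $X$ that covers $X$ with $X\notin\mathcal{U}$ such that for every $B\in\mathfrak{B}$ there are $U\in\mathcal{U}$ and $\delta>0$ with $B^\delta\subseteq U$; $\mathcal{O}_{\mathfrak{B}^s}$ is the collection of all of them. In the game $\mathcal{O}_{\mathfrak{B}^s}(X)$, in each round $n\in\mathbb{N}$ ONE chooses $B_n\in\mathfrak{B}$ and TWO responds with an open set $U_n\ne X$ such that $B_n^{\delta_n}\subseteq U_n$ for some $\delta_n>0$. ONE wins if $\{U_n:n\in\mathbb{N}\}$ is an open $\mathfrak{B}^s$-cover of $X$; otherwise TWO wins. In the game $\mathsf{G}_1(\mathcal{A},\mathcal{C})$,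 in each round $n$ ONE chooses $A_n\in\mathcal{A}$ and TWO responds with $b_n\in A_n$; TWO wins if $\{b_n:n\in\mathbb{N}\}\in\mathcal{C}$, otherwise ONE wins. Strategies are with full memory of the opponent's moves so far. *)

theory Defs
  imports "HOL-Analysis.Analysis"
begin

text \<open>The metric space \<open>X\<close> is a type of class \<open>metric_space\<close>, so \<open>X\<close> itself is \<open>UNIV\<close>.\<close>

definition bornology :: "'a set set \<Rightarrow> bool" where
  "bornology \<BB> \<longleftrightarrow>
     \<Union>\<BB> = UNIV \<and>
     (\<forall>\<F>. finite \<F> \<and> \<F> \<subseteq> \<BB> \<longrightarrow> \<Union>\<F> \<in> \<BB>) \<and>
     (\<forall>B\<in>\<BB>. \<forall>A. A \<subseteq> B \<longrightarrow> A \<in> \<BB>)"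

definition bornology_base :: "'a set set \<Rightarrow> 'a set set \<Rightarrow> bool" where
  "bornology_base \<BB>\<^sub>0 \<BB> \<longleftrightarrow> \<BB>\<^sub>0 \<subseteq> \<BB> \<and> (\<forall>B\<in>\<BB>. \<exists>B\<^sub>0\<in>\<BB>\<^sub>0. B \<subseteq> B\<^sub>0)"

definition has_closed_base :: "'a::topological_space set set \<Rightarrow> bool" where
  "has_closed_base \<BB> \<longleftrightarrow> (\<exists>\<BB>\<^sub>0. bornology_base \<BB>\<^sub>0 \<BB> \<and> (\<forall>B\<in>\<BB>\<^sub>0. closed B))"

definition enlargement :: "'a::metric_space set \<Rightarrow> real \<Rightarrow> 'a set" where
  "enlargement B \<delta> = (\<Union>x\<in>B. {y. dist x y < \<delta>})"

definition open_Bs_covers :: "'a::metric_space set set \<Rightarrow> 'a set set set" where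
  "open_Bs_covers \<BB> =
     {\<U>. (\<forall>U\<in>\<U>. open U) \<and> \<Union>\<U> = UNIV \<and> UNIV \<notin> \<U> \<and>
          (\<forall>B\<in>\<BB>. \<exists>U\<in>\<U>. \<exists>\<delta>>0. enlargement B \<delta> \<subseteq> U)}"

text \<open>In both games a strategy maps the finite list of the opponent's moves so far, in
  chronological order, to the player's next move.\<close>

text \<open>The game \<open>O\<^bsub>\<BB>\<^sup>s\<^esub>(X)\<close>. TWO moves second, so the history of ONE's moves is nonempty and
  its last entry is the set played by ONE in the current round.\<close>

definition TWO_strategy_Bs_game ::
    "'a::metric_space set set \<Rightarrow> ('a set list \<Rightarrow> 'a set) \<Rightarrow> bool" where
  "TWO_strategy_Bs_game \<BB> \<tau> \<longleftrightarrow>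
     (\<forall>Bs. Bs \<noteq> [] \<and> set Bs \<subseteq> \<BB> \<longrightarrow>
        open (\<tau> Bs) \<and> \<tau> Bs \<noteq> UNIV \<and> (\<exists>\<delta>>0. enlargement (last Bs) \<delta> \<subseteq> \<tau> Bs))"

definition TWO_winning_strategy_Bs_game ::
    "'a::metric_space set set \<Rightarrow> ('a set list \<Rightarrow> 'a set) \<Rightarrow> bool" where
  "TWO_winning_strategy_Bs_game \<BB> \<tau> \<longleftrightarrow>
     TWO_strategy_Bs_game \<BB> \<tau> \<and>
     (\<forall>B :: nat \<Rightarrow> 'a set. (\<forall>n. B n \<in> \<BB>) \<longrightarrow>
        range (\<lambda>n. \<tau> (map B [0..<Suc n])) \<notin> open_Bs_covers \<BB>)"

text \<open>The game \<open>G\<^sub>1(\<A>, \<C>)\<close>. A strategy of ONE has to be legal only at histories that can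
  arise when ONE follows it, that is, when TWO has always picked an element of ONE's move.\<close>

definition ONE_strategy_G1 :: "'b set set \<Rightarrow> ('b list \<Rightarrow> 'b set) \<Rightarrow> bool" where
  "ONE_strategy_G1 \<A> \<sigma> \<longleftrightarrow>
     (\<forall>bs. (\<forall>i<length bs. bs ! i \<in> \<sigma> (take i bs)) \<longrightarrow> \<sigma> bs \<in> \<A>)"

definition ONE_winning_strategy_G1 ::
    "'b set set \<Rightarrow> 'b set set \<Rightarrow> ('b list \<Rightarrow> 'b set) \<Rightarrow> bool" where
  "ONE_winning_strategy_G1 \<A> \<C> \<sigma> \<longleftrightarrow>
     ONE_strategy_G1 \<A> \<sigma> \<and>
     (\<forall>b :: nat \<Rightarrow> 'b. (\<forall>n. b n \<in> \<sigma> (map b [0..<n])) \<longrightarrow> range b \<notin> \<C>)"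

end

theory Submission
  imports Defs
begin

text \<open>
  A strategy in one game is turned into a strategy in the other by simulating the other game move by
  move. The point is that, when TWO follows \<open>\<tau>\<close> and has so far been shown \<open>B\<^sub>0, \<dots>, B\<^bsub>n-1\<^esub>\<close>, her
  possible answers \<open>\<tau>(B\<^sub>0, \<dots>, B\<^bsub>n-1\<^esub>, B)\<close> with \<open>B \<in> \<BB>\<close> form an open \<open>\<BB>\<^sup>s\<close>-cover, which ONE can
  play in \<open>G\<^sub>1\<close>; an element picked from it is answered by a \<open>B\<close> that produces it. Conversely, an
  open \<open>\<BB>\<^sup>s\<close>-cover played by ONE in \<open>G\<^sub>1\<close> contains a legal answer of TWO to every \<open>B \<in> \<BB>\<close>.
\<close>

text \<open>The rule \<open>c\<close> is fed its own earlier outputs, not the earlier inputs: these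
  outputs are the history of the simulated game, on which its next move depends.\<close>

definition transcript :: "('b list \<Rightarrow> 'a \<Rightarrow> 'b) \<Rightarrow> 'a list \<Rightarrow> 'b list" where
  "transcript c = foldl (\<lambda>ys x. ys @ [c ys x]) []"

lemma transcript_Nil [simp]: "transcript c [] = []"
  by (simp add: transcript_def)

lemma transcript_snoc [simp]:
  "transcript c (xs @ [x]) = transcript c xs @ [c (transcript c xs) x]"
  by (simp add: transcript_def)

text \<open>Shows that the transcripts of the prefixes of an infinite play are themselves prefixes
  of a single sequence, so an infinite play of one game yields an infinite play of the
  other.\<close>

lemma transcript_map_upt:
  "transcript c (map x [0..<n]) = map (\<lambda>k. c (transcript c (map x [0..<k])) (x k)) [0..<n]"
  by (induction n) auto

lemma enlargement_superset: "0 < \<delta> \<Longrightarrow> B \<subseteq> enlargement B \<delta>"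
  unfolding enlargement_def by fastforce

lemma bornology_singleton:
  assumes "bornology \<BB>"
  shows "{x} \<in> \<BB>"
proof -
  have "x \<in> \<Union>\<BB>"
    using assms by (simp add: bornology_def)
  then show ?thesis
    using assms unfolding bornology_def by (metis UnionE empty_subsetI insert_subset)
qed

text \<open>Covering the space comes for free: each singleton lies in \<BB>, and a set is contained
  in its enlargements.\<close>

lemma open_Bs_coversI:
  assumes "bornology \<BB>"
    and "\<And>U. U \<in> \<U> \<Longrightarrow> open U" and "UNIV \<notin> \<U>"
    and ex: "\<And>B. B \<in> \<BB> \<Longrightarrow> \<exists>U\<in>\<U>. \<exists>\<delta>>0. enlargement B \<delta> \<subseteq> U"
  shows "\<U> \<in> open_Bs_covers \<BB>"
proof -
  have "x \<in> \<Union>\<U>" for x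
    using ex[OF bornology_singleton[OF assms(1), of x]] enlargement_superset[of _ "{x}"] by blast
  then show ?thesis
    using assms by (auto simp: open_Bs_covers_def)
qed

lemma TWO_answers_cover:
  assumes "bornology \<BB>" and "TWO_strategy_Bs_game \<BB> \<tau>" and "set Bs \<subseteq> \<BB>"
  shows "(\<lambda>B. \<tau> (Bs @ [B])) ` \<BB> \<in> open_Bs_covers \<BB>"
proof -
  have legal: "open (\<tau> (Bs @ [B])) \<and> \<tau> (Bs @ [B]) \<noteq> UNIV \<and>
      (\<exists>\<delta>>0. enlargement B \<delta> \<subseteq> \<tau> (Bs @ [B]))" if "B \<in> \<BB>" for B
    using assms(2)[unfolded TWO_strategy_Bs_game_def, rule_format, of "Bs @ [B]"] assms(3) that
    by simp
  show ?thesis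
  proof (rule open_Bs_coversI[OF assms(1)])
    show "\<exists>U\<in>(\<lambda>B. \<tau> (Bs @ [B])) ` \<BB>. \<exists>\<delta>>0. enlargement B \<delta> \<subseteq> U" if "B \<in> \<BB>" for B
      using legal that by blast
  qed (use legal in auto)
qed

lemma ONE_wins_G1_if_TWO_wins_Bs_game:
  assumes "bornology \<BB>" and "TWO_winning_strategy_Bs_game \<BB> \<tau>"
  shows "\<exists>\<sigma>. ONE_winning_strategy_G1 (open_Bs_covers \<BB>) (open_Bs_covers \<BB>) \<sigma>"
proof -
  \<comment> \<open>A preimage of \<open>U\<close> under the answers of \<tau> after
    \<open>Bs\<close>; its value is arbitrary when \<open>U\<close> is no such answer.\<close>
  define c where "c Bs U = (SOME B. B \<in> \<BB> \<and> \<tau> (Bs @ [B]) = U)" for Bs U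
  define \<sigma> where "\<sigma> Us = (\<lambda>B. \<tau> (transcript c Us @ [B])) ` \<BB>" for Us
  have c: "c (transcript c Us) U \<in> \<BB> \<and> \<tau> (transcript c Us @ [c (transcript c Us) U]) = U"
    if "U \<in> \<sigma> Us" for Us U
  proof -
    have "\<exists>B. B \<in> \<BB> \<and> \<tau> (transcript c Us @ [B]) = U"
      using that by (auto simp: \<sigma>_def)
    from someI_ex[OF this] show ?thesis
      by (simp only: c_def[of "transcript c Us"])
  qed
  \<comment> \<open>Since \<tau> is constrained only on lists from \<BB>, legality of the simulated
    history has to be carried along the play.\<close>
  have in_\<BB>: "set (transcript c Us) \<subseteq> \<BB>" if "\<forall>i<length Us. Us ! i \<in> \<sigma> (take i Us)" for Us
    using that
  proof (induction Us rule: rev_induct)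
    case (snoc U Us)
    have "\<forall>i<length Us. Us ! i \<in> \<sigma> (take i Us)"
    proof (intro allI impI)
      fix i assume "i < length Us"
      then show "Us ! i \<in> \<sigma> (take i Us)"
        using snoc.prems[rule_format, of i] by (simp add: nth_append)
    qed
    moreover have "U \<in> \<sigma> Us"
      using snoc.prems[rule_format, of "length Us"] by simp
    ultimately show ?case
      using snoc.IH c by simp
  qed simp
  have "ONE_strategy_G1 (open_Bs_covers \<BB>) \<sigma>"
    using TWO_answers_cover assms in_\<BB>
    unfolding ONE_strategy_G1_def \<sigma>_def TWO_winning_strategy_Bs_game_def by blast
  moreover have "range U \<notin> open_Bs_covers \<BB>" if "\<forall>n. U n \<in> \<sigma> (map U [0..<n])" for U
  proof -
    define B where "B n = c (transcript c (map U [0..<n])) (U n)" for n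
    have transcript_eq: "transcript c (map U [0..<n]) = map B [0..<n]" for n
      unfolding B_def by (rule transcript_map_upt)
    have B: "B n \<in> \<BB>" "\<tau> (map B [0..<Suc n]) = U n" for n
      using c[OF that[rule_format, of n]] by (simp_all add: B_def[of n] transcript_eq)
    \<comment> \<open>Against the moves \<open>B n\<close>, the answers of \<tau> are exactly the
      given sets \<open>U n\<close>, so both plays have the same range.\<close>
    then have "range (\<lambda>n. \<tau> (map B [0..<Suc n])) \<notin> open_Bs_covers \<BB>"
      using assms(2) unfolding TWO_winning_strategy_Bs_game_def by blast
    then show ?thesis
      unfolding B(2) by simp
  qed
  ultimately show ?thesis
    unfolding ONE_winning_strategy_G1_def by blast
qed

lemma TWO_wins_Bs_game_if_ONE_wins_G1:
  assumes "ONE_winning_strategy_G1 (open_Bs_covers \<BB>) (open_Bs_covers \<BB>) \<sigma>"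
  shows "\<exists>\<tau>. TWO_winning_strategy_Bs_game \<BB> \<tau>"
proof -
  define c where "c Us B = (SOME U. U \<in> \<sigma> Us \<and> (\<exists>\<delta>>0. enlargement B \<delta> \<subseteq> U))" for Us B
  \<comment> \<open>The last entry of the transcript is the reply to the current move of ONE; the
    unspecified \<open>last []\<close> never arises, as TWO moves second.\<close>
  define \<tau> where "\<tau> Bs = last (transcript c Bs)" for Bs
  have strategy: "\<sigma> Us \<in> open_Bs_covers \<BB>" if "\<forall>i<length Us. Us ! i \<in> \<sigma> (take i Us)" for Us
    using assms that unfolding ONE_winning_strategy_G1_def ONE_strategy_G1_def by blast
  have c: "c Us B \<in> \<sigma> Us \<and> (\<exists>\<delta>>0. enlargement B \<delta> \<subseteq> c Us B)"
    if "\<sigma> Us \<in> open_Bs_covers \<BB>" "B \<in> \<BB>" for Us B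
  proof -
    have "\<exists>U. U \<in> \<sigma> Us \<and> (\<exists>\<delta>>0. enlargement B \<delta> \<subseteq> U)"
      using that unfolding open_Bs_covers_def by blast
    from someI_ex[OF this] show ?thesis
      by (simp only: c_def)
  qed
  \<comment> \<open>Legality and the cover property feed each other: \<sigma> plays a cover only at
    legal histories, and only from a cover is \<open>c\<close> sure to pick a legal next entry.
    Hence the induction from the right.\<close>
  have legal: "\<forall>i<length (transcript c Bs). transcript c Bs ! i \<in> \<sigma> (take i (transcript c Bs))"
    if "set Bs \<subseteq> \<BB>" for Bs
    using that
  proof (induction Bs rule: rev_induct)
    case (snoc B Bs)
    then show ?case
      using c[OF strategy, of "transcript c Bs" B] by (auto simp: nth_append less_Suc_eq)
  qed simp
  have cover: "\<sigma> (transcript c Bs) \<in> open_Bs_covers \<BB>" if "set Bs \<subseteq> \<BB>" for Bs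
    using strategy legal that by blast
  have "TWO_strategy_Bs_game \<BB> \<tau>"
    unfolding TWO_strategy_Bs_game_def
  proof (intro allI impI)
    fix Bs assume Bs: "Bs \<noteq> [] \<and> set Bs \<subseteq> \<BB>"
    then obtain Bs' B where eq: "Bs = Bs' @ [B]"
      by (metis rev_exhaust)
    have cover': "\<sigma> (transcript c Bs') \<in> open_Bs_covers \<BB>"
      using cover Bs eq by simp
    then have "\<tau> Bs \<in> \<sigma> (transcript c Bs')" "\<exists>\<delta>>0. enlargement B \<delta> \<subseteq> \<tau> Bs"
      using c Bs eq by (simp_all add: \<tau>_def)
    \<comment> \<open>Openness and properness are inherited from membership in the cover played by
      \<sigma>.\<close>
    then show "open (\<tau> Bs) \<and> \<tau> Bs \<noteq> UNIV \<and> (\<exists>\<delta>>0. enlargement (last Bs) \<delta> \<subseteq> \<tau> Bs)"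
      using cover' eq by (auto simp: open_Bs_covers_def)
  qed
  moreover have "range (\<lambda>n. \<tau> (map B [0..<Suc n])) \<notin> open_Bs_covers \<BB>" if "\<forall>n. B n \<in> \<BB>" for B
  proof -
    define U where "U n = \<tau> (map B [0..<Suc n])" for n
    have U_eq: "U n = c (transcript c (map B [0..<n])) (B n)" for n
      by (simp add: U_def \<tau>_def)
    \<comment> \<open>The answers of \<tau> form a play of the other game against \<sigma>, because
      the transcript on which \<sigma> is consulted is the list of earlier answers.\<close>
    have "U n \<in> \<sigma> (map U [0..<n])" for n
    proof -
      have "transcript c (map B [0..<n]) = map U [0..<n]"
        using transcript_map_upt[of c B n] by (simp add: U_eq)
      moreover have "\<sigma> (transcript c (map B [0..<n])) \<in> open_Bs_covers \<BB>"
        using that by (intro cover) auto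
      ultimately show ?thesis
        using c that U_eq by metis
    qed
    then have "range U \<notin> open_Bs_covers \<BB>"
      using assms unfolding ONE_winning_strategy_G1_def by blast
    then show ?thesis
      by (simp add: U_def)
  qed
  ultimately show ?thesis
    unfolding TWO_winning_strategy_Bs_game_def by blast
qed

theorem theorem5p4:
  fixes \<BB> :: "'a::metric_space set set"
  assumes "infinite (UNIV :: 'a set)"
    and "bornology \<BB>"
    and "has_closed_base \<BB>"
    and "UNIV \<notin> \<BB>"
  shows "(\<exists>\<tau>. TWO_winning_strategy_Bs_game \<BB> \<tau>) \<longleftrightarrow>
         (\<exists>\<sigma>. ONE_winning_strategy_G1 (open_Bs_covers \<BB>) (open_Bs_covers \<BB>) \<sigma>)"
  using ONE_wins_G1_if_TWO_wins_Bs_game[OF assms(2)] TWO_wins_Bs_game_if_ONE_wins_G1 by blast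

end
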